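(* Let $h>0$, let $N_0,\dots,N_7\ge 2$ be integers, and let $K_h=\{m=(m_0,\dots,m_7)\in\mathbb{Z}^8: 1\le m_i\le N_i-1,\ i=0,\dots,7\}$. For $j=0,\dots,7$ let $\gamma_{h,2j}^{*}$ (left boundary part) be the set of points $mh$ with $m_j=0$ and $1\le m_l\le N_l-1$ for $l\ne j$, and let $\gamma_{h,2j+1}^{*}$ (right boundary part) be the set of points $mh$ with $m_j=N_j$ and $1\le m_l\le N_l-1$ for $l\neq j$. Let $f=\sum_{k=0}^7 f_k\mathbf{e}_k$ and $g=\sum_{i=0}^7 g_i\mathbf{e}_i$ be discrete functions on $h\mathbb{Z}^8$ with real-valued components. Then $$\sum_{m\in K_{h}} \left[ \left( g(mh)D_h^{-+}\right) f(mh) + g(mh) \left( D_h^{+-}f(mh) \right) \right] h^{8}$$ $$= -\sum_{j=0}^{7}\sum_{mh\in\gamma_{h,2j}^{*}} \left[g(mh)\left(\mathbf{e}_{j}^{+}f(mh+\mathbf{e}_{j}h)\right) + g(mh+\mathbf{e}_{j}h)\left(\mathbf{e}_{j}^{-}f(mh)\right) \right]h^{7}$$ $$+ \sum_{j=0}^{7}\sum_{mh\in\gamma_{h,2j+1}^{*}} \left[g(mh-\mathbf{e}_{j}h)\left(\mathbf{e}_{j}^{+}f(mh)\right) + g(mh)\left(\mathbf{e}_{j}^{-}f(mh-\mathbf{e}_{j}h)\right) \right]h^{7}$$ $$+ 2\sum_{m\in K_{h}} \sum_{s=1}^{7} \sum_{i\in I_{s}} \sum_{j\in I_{s},\,j\neq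 i}\ \sum_{1\le k\le7,\ k\notin I_{s}} \left[g_{i}(mh)\,\partial_{h}^{+j}f_{k}(mh)\,\mathbf{e}_{i}\left(\mathbf{e}_{j}^{+}\mathbf{e}_{k}\right) + g_{i}(mh)\,\partial_{h}^{-j}f_{k}(mh)\,\mathbf{e}_{i}\left(\mathbf{e}_{j}^{-}\mathbf{e}_{k}\right)\right]h^{8}$$ $$+ 2 \sum_{s=1}^{7} \sum_{i\in I_{s}} \sum_{j\in I_{s},\,j\neq i}\ \sum_{1\le k\le 7,\ k\notin I_{s}}\ \sum_{mh\in\gamma_{h,2j}^{*}}\left[g_{i}(mh)f_{k}(mh+\mathbf{e}_{j}h)\,\mathbf{e}_{i}\left(\mathbf{e}_{j}^{+}\mathbf{e}_{k}\right) + g_{i}(mh+\mathbf{e}_{j}h)f_{k}(mh)\,\mathbf{e}_{i}\left(\mathbf{e}_{j}^{-}\mathbf{e}_{k}\right)\right]h^{7}$$ $$- 2\sum_{s=1}^{7} \sum_{i\in I_{s}} \sum_{j\in I_{s},\,j\neq i}\ \sum_{1\le k\le7,\ k\notin I_{s}}\ \sum_{mh\in\gamma_{h,2j+1}^{*}} \left[g_{i}(mh-\mathbf{e}_{j}h)f_{k}(mh)\,\mathbf{e}_{i}\left(\mathbf{e}_{j}^{+}\mathbf{e}_{k}\right) + g_{i}(mh)f_{k}(mh-\mathbf{e}_{j}h)\,\mathbf{e}_{i}\left(\mathbf{e}_{j}^{-}\mathbf{e}_{k}\right)\right]h^{7},$$ where $I_1=\{1,2,4\}$, $I_2=\{1,3,5\}$,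 $I_3=\{1,6,7\}$, $I_4=\{2,3,6\}$, $I_5=\{2,5,7\}$, $I_6=\{3,4,7\}$, $I_7=\{4,5,6\}$.
   Context: Lattice and differences: $h\mathbb{Z}^8=\{mh: m\in\mathbb{Z}^8\}$, with coordinates indexed $0,\dots,7$. For a function $u$ on $h\mathbb{Z}^8$ and $j\in\{0,\dots,7\}$, $\partial_h^{+j}u(mh)=h^{-1}(u(mh+\mathbf{e}_jh)-u(mh))$ and $\partial_h^{-j}u(mh)=h^{-1}(u(mh)-u(mh-\mathbf{e}_jh))$, where in arguments $\mathbf{e}_j$ denotes the $j$-th standard basis vector of $\mathbb{Z}^8$. Algebra (Weyl calculus splitting of the octonionic basis): one works in a real unital, not necessarily associative, algebra containing elements $\mathbf{e}_j^+,\mathbf{e}_j^-$ ($j=0,\dots,7$), with $\mathbf{e}_j:=\mathbf{e}_j^++\mathbf{e}_j^-$, satisfying for all $j,k$: $\mathbf{e}_j^-\mathbf{e}_k^-+\mathbf{e}_k^-\mathbf{e}_j^-=0$, $\mathbf{e}_j^+\mathbf{e}_k^++\mathbf{e}_k^+\mathbf{e}_j^+=0$, $\mathbf{e}_j^+\mathbf{e}_k^-+\mathbf{e}_k^-\mathbf{e}_j^+=-\delta_{jk}$. Moreover, for all choices of signs $\alpha,\beta,\gamma\in\{+,-\}$: $(\mathbf{e}_i^\alpha\mathbf{e}_j^\beta)\mathbf{e}_k^\gamma=-\mathbf{e}_i^\alpha(\mathbf{e}_j^\beta\mathbf{e}_k^\gamma)$ if $i,j,k$ are mutually distinct and nonzero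 and $\{i,j,k\}$ is not one of the sets $I_1=\{1,2,4\}$, $I_2=\{1,3,5\}$, $I_3=\{1,6,7\}$, $I_4=\{2,3,6\}$, $I_5=\{2,5,7\}$, $I_6=\{3,4,7\}$, $I_7=\{4,5,6\}$ (these sets are the octonionic triples with $\mathbf{e}_i\mathbf{e}_j=\pm\mathbf{e}_k$); and $(\mathbf{e}_i^\alpha\mathbf{e}_j^\beta)\mathbf{e}_k^\gamma=\mathbf{e}_i^\alpha(\mathbf{e}_j^\beta\mathbf{e}_k^\gamma)$ for all other index triples $i,j,k\in\{0,\dots,7\}$. A discrete function is a function $f=\sum_{k=0}^7 f_k\mathbf{e}_k$ with real-valued components $f_k$; differences act componentwise. Discrete Cauchy-Riemann operators: $D_h^{+-}f=\sum_{j=0}^7\left(\mathbf{e}_j^+\partial_h^{+j}f+\mathbf{e}_j^-\partial_h^{-j}f\right)$ (acting from the left), and $gD_h^{-+}=\sum_{j=0}^7\left((\partial_h^{-j}g)\mathbf{e}_j^++(\partial_h^{+j}g)\mathbf{e}_j^-\right)$ (acting from the right). *)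

theory Defs
  imports "HOL-Analysis.Finite_Cartesian_Product"
begin

text \<open>
  The classes \<open>real_algebra\<close> and
  \<open>real_algebra_1\<close> of the library assume associativity, so bilinearity and the unit laws
  are axiomatised here directly. As \<open>1 \<noteq> 0\<close> is not assumed, the zero algebra is allowed.
\<close>

class real_nonassoc_algebra_1 = real_vector + times + one +
  assumes na_distrib_right: "(a + b) * c = a * c + b * c"
    and na_distrib_left: "a * (b + c) = a * b + a * c"
    and na_scaleR_left: "(r *\<^sub>R a) * b = r *\<^sub>R (a * b)"
    and na_scaleR_right: "a * (r *\<^sub>R b) = r *\<^sub>R (a * b)"
    and na_one_left: "1 * a = a"
    and na_one_right: "a * 1 = a"

text \<open>
  The index set \<open>{0,\<dots>,7}\<close> is the numeral type \<open>8\<close>; its numerals are residues modulo 8, with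
  the order of \<open>0 < 1 < \<dots> < 7\<close>.
\<close>

lemma index_range: "{0..7} = (UNIV :: 8 set)" "{1..7} = UNIV - {0 :: 8}"
proof -
  have cases: "k = 0 \<or> k = 1 \<or> k = 2 \<or> k = 3 \<or> k = 4 \<or> k = 5 \<or> k = 6 \<or> k = 7" for k :: 8
  proof (rule bit0_cases[of k])
    fix z :: int
    assume "k = of_int z" "0 \<le> z" "z < int CARD(8)"
    moreover from this have "z = 0 \<or> z = 1 \<or> z = 2 \<or> z = 3 \<or> z = 4 \<or> z = 5 \<or> z = 6 \<or> z = 7"
      by auto
    ultimately show ?thesis by auto
  qed
  have "0 \<le> k \<and> k \<le> 7" "1 \<le> k \<longleftrightarrow> k \<noteq> 0" for k :: 8
    using cases[of k] by (auto simp: less_eq_bit0_def bit0.Rep_0 bit0.Rep_1 bit0.Rep_numeral)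
  then show "{0..7} = (UNIV :: 8 set)" "{1..7} = UNIV - {0 :: 8}" by auto
qed

text \<open>The triples are numbered from 1; outside \<open>1 \<le> s \<le> 7\<close> the value is irrelevant.\<close>

definition oct_triple :: "nat \<Rightarrow> 8 set" where
  "oct_triple s =
     [{1, 2, 4}, {1, 3, 5}, {1, 6, 7}, {2, 3, 6}, {2, 5, 7}, {3, 4, 7}, {4, 5, 6}] ! (s - 1)"

definition antiassoc_indices :: "8 \<Rightarrow> 8 \<Rightarrow> 8 \<Rightarrow> bool" where
  "antiassoc_indices i j k \<longleftrightarrow>
     i \<noteq> j \<and> i \<noteq> k \<and> j \<noteq> k \<and> i \<noteq> 0 \<and> j \<noteq> 0 \<and> k \<noteq> 0 \<and>
     (\<forall>s\<in>{1..7}. {i, j, k} \<noteq> oct_triple s)"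

text \<open>
  The splitting \<open>e\<^sub>j = e\<^sub>j\<^sup>+ + e\<^sub>j\<^sup>-\<close> of the octonionic basis: \<open>ep j\<close> and \<open>em j\<close> stand for
  \<open>e\<^sub>j\<^sup>+\<close> and \<open>e\<^sub>j\<^sup>-\<close>, and letting \<open>a\<close>, \<open>b\<close>, \<open>c\<close> range over two-element sets expresses
  ``for all choices of signs''.
\<close>

locale weyl_octonion_splitting =
  fixes ep em :: "8 \<Rightarrow> 'a :: real_nonassoc_algebra_1"
  assumes em_em: "em j * em k + em k * em j = 0"
    and ep_ep: "ep j * ep k + ep k * ep j = 0"
    and ep_em: "ep j * em k + em k * ep j = - (if j = k then 1 else 0)"
    and antiassoc:
      "\<lbrakk>antiassoc_indices i j k; a \<in> {ep i, em i}; b \<in> {ep j, em j}; c \<in> {ep k, em k}\<rbrakk>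
        \<Longrightarrow> (a * b) * c = - (a * (b * c))"
    and assoc:
      "\<lbrakk>\<not> antiassoc_indices i j k; a \<in> {ep i, em i}; b \<in> {ep j, em j}; c \<in> {ep k, em k}\<rbrakk>
        \<Longrightarrow> (a * b) * c = a * (b * c)"

text \<open>
  Lattice functions are modelled as functions on all of \<open>\<real>\<^sup>8\<close>; at a lattice point the
  differences below only involve values at lattice points.
\<close>

definition lattice_point :: "real \<Rightarrow> int ^ 8 \<Rightarrow> real ^ 8" where
  "lattice_point h m = h *\<^sub>R (\<chi> i. real_of_int (m $ i))"

definition lattice_step :: "real \<Rightarrow> 8 \<Rightarrow> real ^ 8" where
  "lattice_step h j = h *\<^sub>R axis j 1"

definition fwd_diff :: "real \<Rightarrow> 8 \<Rightarrow> (real ^ 8 \<Rightarrow> 'b :: real_vector) \<Rightarrow> real ^ 8 \<Rightarrow> 'b" where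
  "fwd_diff h j u x = inverse h *\<^sub>R (u (x + lattice_step h j) - u x)"

definition bwd_diff :: "real \<Rightarrow> 8 \<Rightarrow> (real ^ 8 \<Rightarrow> 'b :: real_vector) \<Rightarrow> real ^ 8 \<Rightarrow> 'b" where
  "bwd_diff h j u x = inverse h *\<^sub>R (u x - u (x - lattice_step h j))"

definition discrete_fun ::
  "(8 \<Rightarrow> 'a :: real_nonassoc_algebra_1) \<Rightarrow> (8 \<Rightarrow> real ^ 8 \<Rightarrow> real) \<Rightarrow> real ^ 8 \<Rightarrow> 'a" where
  "discrete_fun e f x = (\<Sum>k\<in>UNIV. f k x *\<^sub>R e k)"

lemma fwd_diff_discrete_fun:
  "fwd_diff h j (discrete_fun e f) = discrete_fun e (\<lambda>k. fwd_diff h j (f k))"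
  by (rule ext)
    (simp add: fwd_diff_def discrete_fun_def scaleR_sum_right scaleR_diff_left
      flip: sum_subtractf scaleR_scaleR)

lemma bwd_diff_discrete_fun:
  "bwd_diff h j (discrete_fun e f) = discrete_fun e (\<lambda>k. bwd_diff h j (f k))"
  by (rule ext)
    (simp add: bwd_diff_def discrete_fun_def scaleR_sum_right scaleR_diff_left
      flip: sum_subtractf scaleR_scaleR)

text \<open>
  \<open>D_left\<close> is \<open>D\<^sub>h\<^sup>+\<^sup>-\<close>, multiplying from the left, and \<open>D_right\<close> is \<open>D\<^sub>h\<^sup>-\<^sup>+\<close>, multiplying from
  the right; in the latter the roles of forward and backward differences are exchanged.
\<close>

definition D_left ::
  "real \<Rightarrow> (8 \<Rightarrow> 'a) \<Rightarrow> (8 \<Rightarrow> 'a) \<Rightarrow> (real ^ 8 \<Rightarrow> 'a :: real_nonassoc_algebra_1) \<Rightarrow> real ^ 8 \<Rightarrow> 'a"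
  where "D_left h ep em f x =
    (\<Sum>j\<in>UNIV. ep j * fwd_diff h j f x + em j * bwd_diff h j f x)"

definition D_right ::
  "real \<Rightarrow> (8 \<Rightarrow> 'a) \<Rightarrow> (8 \<Rightarrow> 'a) \<Rightarrow> (real ^ 8 \<Rightarrow> 'a :: real_nonassoc_algebra_1) \<Rightarrow> real ^ 8 \<Rightarrow> 'a"
  where "D_right h ep em g x =
    (\<Sum>j\<in>UNIV. bwd_diff h j g x * ep j + fwd_diff h j g x * em j)"

definition interior_indices :: "(8 \<Rightarrow> int) \<Rightarrow> (int ^ 8) set" where
  "interior_indices N = {m. \<forall>i. 1 \<le> m $ i \<and> m $ i \<le> N i - 1}"

definition left_boundary :: "real \<Rightarrow> (8 \<Rightarrow> int) \<Rightarrow> 8 \<Rightarrow> (real ^ 8) set" where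
  "left_boundary h N j =
     lattice_point h ` {m. m $ j = 0 \<and> (\<forall>l. l \<noteq> j \<longrightarrow> 1 \<le> m $ l \<and> m $ l \<le> N l - 1)}"

definition right_boundary :: "real \<Rightarrow> (8 \<Rightarrow> int) \<Rightarrow> 8 \<Rightarrow> (real ^ 8) set" where
  "right_boundary h N j =
     lattice_point h ` {m. m $ j = N j \<and> (\<forall>l. l \<noteq> j \<longrightarrow> 1 \<le> m $ l \<and> m $ l \<le> N l - 1)}"

end

theory Submission
  imports Defs
begin

text \<open>
  For each \<open>j\<close> and \<open>p = e\<^sub>j\<^sup>\<plusminus>\<close>, moving the brackets from \<open>(g p) f\<close> to \<open>g (p f)\<close> costs
  \<open>-2 e\<^sub>i (p e\<^sub>k)\<close> for every anti-associative index triple \<open>(i, j, k)\<close>. After this correction the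
  discrete product rule turns the summand at \<open>x\<close> into a difference \<open>U(x) - U(x - e\<^sub>j h)\<close>, which
  telescopes to the two faces orthogonal to \<open>e\<^sub>j\<close>, plus twice the anti-associative part of
  \<open>g \<partial>\<^sub>j f\<close>. The seven triples are the lines of the Fano plane: two distinct points \<open>i, j\<close> lie
  on exactly one line, so \<open>(i, j, k)\<close> is anti-associative iff \<open>k \<noteq> 0\<close> is off the line through
  \<open>i \<noteq> j\<close>. This matches the sums over \<open>I\<^sub>s\<close>.
\<close>

section \<open>Bilinear arithmetic without associativity\<close>

lemma na_mult_minus: "(a::'a::real_nonassoc_algebra_1) * - b = - (a * b)" "- a * b = - (a * b)"
  using na_scaleR_right[of a "-1" b] na_scaleR_left[of "-1" a b] by simp_all

lemma na_diff_left: "((a::'a::real_nonassoc_algebra_1) - b) * c = a * c - b * c"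
  using na_distrib_right[of a "-b" c] by (simp add: na_mult_minus)

lemma na_diff_right: "(a::'a::real_nonassoc_algebra_1) * (b - c) = a * b - a * c"
  using na_distrib_left[of a b "-c"] by (simp add: na_mult_minus)

lemma na_sum_left: "(\<Sum>i\<in>A. F i) * (b::'a::real_nonassoc_algebra_1) = (\<Sum>i\<in>A. F i * b)"
proof -
  have "(0::'a) * b = 0" using na_scaleR_left[of 0 0 b] by simp
  then show ?thesis
    by (induction A rule: infinite_finite_induct) (simp_all add: na_distrib_right)
qed

lemma na_sum_right: "(a::'a::real_nonassoc_algebra_1) * (\<Sum>i\<in>A. F i) = (\<Sum>i\<in>A. a * F i)"
proof -
  have "a * (0::'a) = 0" using na_scaleR_right[of a 0 0] by simp
  then show ?thesis
    by (induction A rule: infinite_finite_induct) (simp_all add: na_distrib_left)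
qed

section \<open>The octonionic triples as lines of the Fano plane, and anti-associative
  indices\<close>

lemmas eight_eq_simps = bit0.Rep_inject_sym bit0.Rep_0 bit0.Rep_1 bit0.Rep_numeral

lemma eight_cases: "k = 0 \<or> k = 1 \<or> k = 2 \<or> k = 3 \<or> k = 4 \<or> k = 5 \<or> k = 6 \<or> k = 7" for k :: 8
proof -
  have "{0, 1, 2, 3, 4, 5, 6, 7} = (UNIV :: 8 set)"
    \<comment> \<open>Comparing integer representatives shows the eight numerals to be distinct, so
      the set has as many elements as the type.\<close>
    by (rule card_eq_UNIV_imp_eq_UNIV) (simp_all add: eight_eq_simps)
  then show ?thesis using UNIV_I[of k] by blast
qed

lemma triple_index_cases: "s \<in> {1..7} \<longleftrightarrow> s = 1 \<or> s = 2 \<or> s = 3 \<or> s = 4 \<or> s = 5 \<or> s = 6 \<or> s = 7"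
  for s :: nat
  by auto

lemma oct_triple_simps:
  "oct_triple (Suc 0) = {1, 2, 4}" "oct_triple 2 = {1, 3, 5}" "oct_triple 3 = {1, 6, 7}"
  "oct_triple 4 = {2, 3, 6}" "oct_triple 5 = {2, 5, 7}" "oct_triple 6 = {3, 4, 7}"
  "oct_triple 7 = {4, 5, 6}"
  by (simp_all add: oct_triple_def)

text \<open>A finite check over all pairs of nonzero indices, the diagonal \<open>i = j\<close>
  included.\<close>

lemma oct_triple_ex:
  assumes "i \<noteq> 0" "j \<noteq> 0"
  shows "\<exists>s\<in>{1..7}. i \<in> oct_triple s \<and> j \<in> oct_triple s"
proof -
  have set_eq: "{1..7} = {Suc 0, 2, 3, 4, 5, 6, 7}" by auto
  show ?thesis
    unfolding set_eq
    using eight_cases[of i] eight_cases[of j] assms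
    by (elim disjE) (simp_all add: oct_triple_simps eight_eq_simps)
qed

text \<open>The dual incidence property of the Fano plane, checked over all pairs of lines. It
  supplies uniqueness in \<open>oct_triple_ex1\<close>: two different lines cannot share two
  distinct points.\<close>

lemma oct_triple_Int_card:
  assumes "s \<in> {1..7}" "t \<in> {1..7}" "s \<noteq> t"
  shows "card (oct_triple s \<inter> oct_triple t) = 1"
  using assms unfolding triple_index_cases
  by (elim disjE) (simp_all add: oct_triple_simps eight_eq_simps)

lemma oct_triple_ex1:
  assumes "i \<noteq> 0" "j \<noteq> 0" "i \<noteq> j"
  shows "\<exists>!s. s \<in> {1..7} \<and> i \<in> oct_triple s \<and> j \<in> oct_triple s"
proof -
  have "s = t" if "s \<in> {1..7}" "i \<in> oct_triple s" "j \<in> oct_triple s"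
      "t \<in> {1..7}" "i \<in> oct_triple t" "j \<in> oct_triple t" for s t
  proof (rule ccontr)
    assume "s \<noteq> t"
    then have "card (oct_triple s \<inter> oct_triple t) = 1" using that by (intro oct_triple_Int_card)
    then obtain x where "oct_triple s \<inter> oct_triple t = {x}" by (rule card_1_singletonE)
    then have "i = x" "j = x" using that by auto
    then show False using \<open>i \<noteq> j\<close> by simp
  qed
  then show ?thesis using oct_triple_ex[OF assms(1,2)] by blast
qed

lemma oct_triple_card: "s \<in> {1..7} \<Longrightarrow> card (oct_triple s) = 3"
  unfolding triple_index_cases by (elim disjE) (simp_all add: oct_triple_simps eight_eq_simps)

lemma zero_notin_oct_triple: "s \<in> {1..7} \<Longrightarrow> 0 \<notin> oct_triple s"
  unfolding triple_index_cases by (elim disjE) (simp_all add: oct_triple_simps eight_eq_simps)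

lemma antiassoc_indices_iff:
  "antiassoc_indices i j k \<longleftrightarrow>
    (\<exists>s\<in>{1..7}. i \<in> oct_triple s \<and> j \<in> oct_triple s \<and> j \<noteq> i \<and> k \<noteq> 0 \<and> k \<notin> oct_triple s)"
proof
  assume A: "antiassoc_indices i j k"
  then have d: "i \<noteq> j" "i \<noteq> k" "j \<noteq> k" "i \<noteq> 0" "j \<noteq> 0" "k \<noteq> 0"
    by (auto simp: antiassoc_indices_def)
  then obtain s where s: "s \<in> {1..7}" "i \<in> oct_triple s" "j \<in> oct_triple s"
    using oct_triple_ex1[of i j] by blast
  have "k \<notin> oct_triple s"
  proof
    assume "k \<in> oct_triple s"
    \<comment> \<open>Three distinct points on a line of three points exhaust it.\<close>
    then have "{i, j, k} = oct_triple s"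
      using s d oct_triple_card[of s] by (intro card_subset_eq) auto
    then show False using A s(1) by (auto simp: antiassoc_indices_def)
  qed
  then show "\<exists>s\<in>{1..7}. i \<in> oct_triple s \<and> j \<in> oct_triple s \<and> j \<noteq> i \<and> k \<noteq> 0 \<and> k \<notin> oct_triple s"
    using s d by blast
next
  assume "\<exists>s\<in>{1..7}. i \<in> oct_triple s \<and> j \<in> oct_triple s \<and> j \<noteq> i \<and> k \<noteq> 0 \<and> k \<notin> oct_triple s"
  then obtain s where s: "s \<in> {1..7}" "i \<in> oct_triple s" "j \<in> oct_triple s"
      "j \<noteq> i" "k \<noteq> 0" "k \<notin> oct_triple s"
    by blast
  then have nz: "i \<noteq> 0" "j \<noteq> 0" using zero_notin_oct_triple by auto
  \<comment> \<open>Equality would put \<open>i\<close> and \<open>j\<close> on the line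
    \<open>t\<close>, forcing \<open>t = s\<close> and hence \<open>k\<close> on
    \<open>s\<close>.\<close>
  have "{i, j, k} \<noteq> oct_triple t" if "t \<in> {1..7}" for t
    using oct_triple_ex1[of i j] nz s that by blast
  then show "antiassoc_indices i j k" using s nz by (auto simp: antiassoc_indices_def)
qed

text \<open>The direction \<open>j\<close> stays a parameter because the product rules and the
  telescoping treat one direction at a time. Padding with 0 gives both sums a fixed range, so
  linearity can be checked summand by summand.\<close>

definition antiassoc_sum :: "8 \<Rightarrow> (8 \<Rightarrow> 8 \<Rightarrow> 'a::real_vector) \<Rightarrow> 'a" where
  "antiassoc_sum j F = (\<Sum>i\<in>UNIV. \<Sum>k\<in>UNIV. if antiassoc_indices i j k then F i k else 0)"

lemma antiassoc_sum_add:
  "antiassoc_sum j (\<lambda>i k. F i k + G i k) = antiassoc_sum j F + antiassoc_sum j G"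
  by (auto simp: antiassoc_sum_def simp flip: sum.distrib intro!: sum.cong)

lemma antiassoc_sum_diff:
  "antiassoc_sum j (\<lambda>i k. F i k - G i k) = antiassoc_sum j F - antiassoc_sum j G"
  by (auto simp: antiassoc_sum_def simp flip: sum_subtractf intro!: sum.cong)

lemma antiassoc_sum_scaleR:
  "antiassoc_sum j (\<lambda>i k. r *\<^sub>R F i k) = r *\<^sub>R antiassoc_sum j F"
  by (auto simp: antiassoc_sum_def scaleR_sum_right intro!: sum.cong)

lemma antiassoc_sum_sum:
  "antiassoc_sum j (\<lambda>i k. \<Sum>x\<in>A. F x i k) = (\<Sum>x\<in>A. antiassoc_sum j (F x))"
proof (induction A rule: infinite_finite_induct)
  case (insert x A)
  then show ?case by (simp add: antiassoc_sum_add)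
qed (simp_all add: antiassoc_sum_def)

text \<open>Since \<open>i\<close> and \<open>j\<close> determine \<open>s\<close>, forgetting
  \<open>s\<close> is a bijection onto the anti-associative triples. Afterwards \<open>j\<close> can
  be moved outermost, which the sums in the theorem need because the faces depend on
  \<open>j\<close>.\<close>

lemma sum_oct_triples:
  "(\<Sum>s\<in>{1..7}. \<Sum>i\<in>oct_triple s. \<Sum>j\<in>oct_triple s - {i}. \<Sum>k\<in>{1..7} - oct_triple s. F i j k)
    = (\<Sum>j\<in>UNIV. antiassoc_sum j (\<lambda>i k. F i j k))"
proof -
  let ?S = "SIGMA s:{1..7}. SIGMA i:oct_triple s. (oct_triple s - {i}) \<times> ({1..7} - oct_triple s)"
  let ?T = "{(i, j, k). antiassoc_indices i j k}"
  have inj: "inj_on snd ?S"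
  proof (rule inj_onI)
    fix y z assume yz: "y \<in> ?S" "z \<in> ?S" "snd y = snd z"
    obtain s t i j k where eq: "y = (s, i, j, k)" "z = (t, i, j, k)"
      using yz(3) by (cases y, cases z) auto
    then have "s \<in> {1..7}" "t \<in> {1..7}" "i \<in> oct_triple s" "i \<in> oct_triple t"
      "j \<in> oct_triple s" "j \<in> oct_triple t" "j \<noteq> i"
      using yz(1,2) by simp_all
    then have "s = t"
      using oct_triple_ex1[of i j] zero_notin_oct_triple by metis
    then show "y = z" using eq by simp
  qed
  have "snd ` ?S = ?T"
    \<comment> \<open>For indices of type \<open>8\<close>, \<open>{1..7}\<close> becomes the set of
      nonzero indices; the natural-number range of \<open>s\<close> is left as an opaque
      membership.\<close>
    unfolding antiassoc_indices_iff index_range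
    by (force simp: image_iff simp del: atLeastAtMost_iff)
  with inj have bij: "bij_betw snd ?S ?T" by (simp add: bij_betw_def)
  have "(\<Sum>s\<in>{1..7}. \<Sum>i\<in>oct_triple s. \<Sum>j\<in>oct_triple s - {i}. \<Sum>k\<in>{1..7} - oct_triple s. F i j k)
      = (\<Sum>y\<in>?S. case snd y of (i, j, k) \<Rightarrow> F i j k)"
    by (simp add: sum.Sigma case_prod_unfold)
  also have "\<dots> = (\<Sum>(i, j, k)\<in>?T. F i j k)"
    by (rule sum.reindex_bij_betw[OF bij])
  also have "\<dots> = (\<Sum>(i, j, k)\<in>UNIV \<times> UNIV \<times> UNIV. if antiassoc_indices i j k then F i j k else 0)"
    by (rule sum.mono_neutral_cong_left) (auto split: if_splits)
  also have "\<dots> = (\<Sum>i\<in>UNIV. \<Sum>j\<in>UNIV. \<Sum>k\<in>UNIV. if antiassoc_indices i j k then F i j k else 0)"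
    by (simp only: sum.cartesian_product)
  also have "\<dots> = (\<Sum>j\<in>UNIV. antiassoc_sum j (\<lambda>i k. F i j k))"
    unfolding antiassoc_sum_def by (rule sum.swap)
  finally show ?thesis .
qed

section \<open>Moving brackets and the discrete product rules\<close>

lemma discrete_fun_mult_left:
  "discrete_fun e u x * (p * discrete_fun e v y)
    = (\<Sum>i\<in>UNIV. \<Sum>k\<in>UNIV. (u i x * v k y) *\<^sub>R (e i * (p * e k)))"
  unfolding discrete_fun_def na_sum_left
  by (simp add: na_sum_left na_sum_right na_scaleR_left na_scaleR_right scaleR_sum_right
      mult.commute[of "v _ _"])

lemma discrete_fun_mult_right:
  "(discrete_fun e u x * p) * discrete_fun e v y
    = (\<Sum>i\<in>UNIV. \<Sum>k\<in>UNIV. (u i x * v k y) *\<^sub>R ((e i * p) * e k))"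
  unfolding discrete_fun_def na_sum_left
  by (simp add: na_sum_left na_sum_right na_scaleR_left na_scaleR_right scaleR_sum_right
      mult.commute[of "v _ _"])

context weyl_octonion_splitting
begin

text \<open>The sign depends on the indices only, not on the chosen halves, so it survives adding
  the two halves of \<open>e i\<close> and of \<open>e k\<close>.\<close>

lemma basis_reassoc:
  assumes e: "e = (\<lambda>j. ep j + em j)" and p: "p \<in> {ep j, em j}"
  shows "(e i * p) * e k = (if antiassoc_indices i j k then - (e i * (p * e k)) else e i * (p * e k))"
proof (cases "antiassoc_indices i j k")
  case True
  then show ?thesis
    using assms antiassoc[OF True _ p] by (simp add: na_distrib_left na_distrib_right)
next
  case False
  then show ?thesis
    using assms assoc[OF False _ p] by (simp add: na_distrib_left na_distrib_right)
qed

lemma discrete_fun_reassoc: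
  assumes e: "e = (\<lambda>j. ep j + em j)" and p: "p \<in> {ep j, em j}"
  shows "(discrete_fun e u x * p) * discrete_fun e v y
    = discrete_fun e u x * (p * discrete_fun e v y)
      - 2 *\<^sub>R antiassoc_sum j (\<lambda>i k. (u i x * v k y) *\<^sub>R (e i * (p * e k)))"
  unfolding discrete_fun_mult_left discrete_fun_mult_right antiassoc_sum_def
    scaleR_sum_right sum_subtractf[symmetric] basis_reassoc[OF e p]
  \<comment> \<open>On an anti-associative triple a term \<open>t\<close> becomes
    \<open>- t\<close>, that is, \<open>t\<close> minus twice \<open>t\<close>.\<close>
  by (intro sum.cong refl) (simp add: scaleR_2)

text \<open>A backward difference on \<open>g\<close> paired with a forward difference on
  \<open>f\<close> makes the products with both arguments at \<open>x\<close> cancel.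
  \<open>P\<close> is the remaining flux between \<open>x\<close> and its forward neighbour,
  including the correction for moving the brackets.\<close>

lemma forward_product_rule:
  fixes fc gc :: "8 \<Rightarrow> real ^ 8 \<Rightarrow> real"
  assumes "h > 0" and e: "e = (\<lambda>j. ep j + em j)" and p: "p \<in> {ep j, em j}"
  defines "f \<equiv> discrete_fun e fc" and "g \<equiv> discrete_fun e gc"
  defines "P \<equiv> \<lambda>x. g x * (p * f (x + lattice_step h j))
    - 2 *\<^sub>R antiassoc_sum j (\<lambda>i k. (gc i x * fc k (x + lattice_step h j)) *\<^sub>R (e i * (p * e k)))"
  shows "h *\<^sub>R ((bwd_diff h j g x * p) * f x + g x * (p * fwd_diff h j f x))
    = P x - P (x - lattice_step h j)
      + (2 * h) *\<^sub>R antiassoc_sum j (\<lambda>i k. (gc i x * fwd_diff h j (fc k) x) *\<^sub>R (e i * (p * e k)))"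
proof -
  let ?d = "lattice_step h j"
  let ?A = "\<lambda>u v. antiassoc_sum j (\<lambda>i k. (u i * v k) *\<^sub>R (e i * (p * e k)))"
  \<comment> \<open>The same cancellation for components, solved for the difference on
    \<open>gc\<close>: bracket moving yields a correction in that difference, while the theorem has
    the difference on \<open>fc\<close>.\<close>
  have scalar: "h * (bwd_diff h j (gc i) x * fc k x)
      = gc i x * fc k (x + ?d) - gc i (x - ?d) * fc k x - h * (gc i x * fwd_diff h j (fc k) x)" for i k
    using \<open>h > 0\<close> by (simp add: bwd_diff_def fwd_diff_def field_simps)
  have "(bwd_diff h j g x * p) * f x = bwd_diff h j g x * (p * f x)
      - 2 *\<^sub>R ?A (\<lambda>i. bwd_diff h j (gc i) x) (\<lambda>k. fc k x)"
    unfolding f_def g_def bwd_diff_discrete_fun by (rule discrete_fun_reassoc[OF e p])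
  then have "h *\<^sub>R ((bwd_diff h j g x * p) * f x + g x * (p * fwd_diff h j f x))
    = (h *\<^sub>R bwd_diff h j g x) * (p * f x) + g x * (p * (h *\<^sub>R fwd_diff h j f x))
      - 2 *\<^sub>R (h *\<^sub>R ?A (\<lambda>i. bwd_diff h j (gc i) x) (\<lambda>k. fc k x))"
    by (simp add: scaleR_add_right scaleR_diff_right na_scaleR_left na_scaleR_right)
  also have "(h *\<^sub>R bwd_diff h j g x) * (p * f x) + g x * (p * (h *\<^sub>R fwd_diff h j f x))
      = g x * (p * f (x + ?d)) - g (x - ?d) * (p * f x)"
    using \<open>h > 0\<close> by (simp add: bwd_diff_def fwd_diff_def na_diff_left na_diff_right)
  also have "h *\<^sub>R ?A (\<lambda>i. bwd_diff h j (gc i) x) (\<lambda>k. fc k x)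
      = ?A (\<lambda>i. gc i x) (\<lambda>k. fc k (x + ?d)) - ?A (\<lambda>i. gc i (x - ?d)) (\<lambda>k. fc k x)
        - h *\<^sub>R ?A (\<lambda>i. gc i x) (\<lambda>k. fwd_diff h j (fc k) x)"
    unfolding antiassoc_sum_scaleR[symmetric] antiassoc_sum_diff[symmetric]
      scaleR_scaleR scaleR_diff_left[symmetric] scalar ..
  finally show ?thesis
    by (simp add: P_def algebra_simps)
qed

text \<open>The mirror image, with \<open>Q x\<close> the flux between \<open>x\<close> and its
  backward neighbour. Hence \<open>Q\<close> at the forward neighbour of \<open>x\<close> crosses
  the same edge as \<open>P x\<close>, and the two can be added to one flux.\<close>

lemma backward_product_rule:
  fixes fc gc :: "8 \<Rightarrow> real ^ 8 \<Rightarrow> real"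
  assumes "h > 0" and e: "e = (\<lambda>j. ep j + em j)" and p: "p \<in> {ep j, em j}"
  defines "f \<equiv> discrete_fun e fc" and "g \<equiv> discrete_fun e gc"
  defines "Q \<equiv> \<lambda>x. g x * (p * f (x - lattice_step h j))
    - 2 *\<^sub>R antiassoc_sum j (\<lambda>i k. (gc i x * fc k (x - lattice_step h j)) *\<^sub>R (e i * (p * e k)))"
  shows "h *\<^sub>R ((fwd_diff h j g x * p) * f x + g x * (p * bwd_diff h j f x))
    = Q (x + lattice_step h j) - Q x
      + (2 * h) *\<^sub>R antiassoc_sum j (\<lambda>i k. (gc i x * bwd_diff h j (fc k) x) *\<^sub>R (e i * (p * e k)))"
proof -
  let ?d = "lattice_step h j"
  let ?A = "\<lambda>u v. antiassoc_sum j (\<lambda>i k. (u i * v k) *\<^sub>R (e i * (p * e k)))"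
  have scalar: "h * (fwd_diff h j (gc i) x * fc k x)
      = gc i (x + ?d) * fc k x - gc i x * fc k (x - ?d) - h * (gc i x * bwd_diff h j (fc k) x)" for i k
    using \<open>h > 0\<close> by (simp add: bwd_diff_def fwd_diff_def field_simps)
  have "(fwd_diff h j g x * p) * f x = fwd_diff h j g x * (p * f x)
      - 2 *\<^sub>R ?A (\<lambda>i. fwd_diff h j (gc i) x) (\<lambda>k. fc k x)"
    unfolding f_def g_def fwd_diff_discrete_fun by (rule discrete_fun_reassoc[OF e p])
  then have "h *\<^sub>R ((fwd_diff h j g x * p) * f x + g x * (p * bwd_diff h j f x))
    = (h *\<^sub>R fwd_diff h j g x) * (p * f x) + g x * (p * (h *\<^sub>R bwd_diff h j f x))
      - 2 *\<^sub>R (h *\<^sub>R ?A (\<lambda>i. fwd_diff h j (gc i) x) (\<lambda>k. fc k x))"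
    by (simp add: scaleR_add_right scaleR_diff_right na_scaleR_left na_scaleR_right)
  also have "(h *\<^sub>R fwd_diff h j g x) * (p * f x) + g x * (p * (h *\<^sub>R bwd_diff h j f x))
      = g (x + ?d) * (p * f x) - g x * (p * f (x - ?d))"
    using \<open>h > 0\<close> by (simp add: bwd_diff_def fwd_diff_def na_diff_left na_diff_right)
  also have "h *\<^sub>R ?A (\<lambda>i. fwd_diff h j (gc i) x) (\<lambda>k. fc k x)
      = ?A (\<lambda>i. gc i (x + ?d)) (\<lambda>k. fc k x) - ?A (\<lambda>i. gc i x) (\<lambda>k. fc k (x - ?d))
        - h *\<^sub>R ?A (\<lambda>i. gc i x) (\<lambda>k. bwd_diff h j (fc k) x)"
    unfolding antiassoc_sum_scaleR[symmetric] antiassoc_sum_diff[symmetric]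
      scaleR_scaleR scaleR_diff_left[symmetric] scalar ..
  finally show ?thesis
    by (simp add: Q_def algebra_simps)
qed

end

section \<open>Telescoping over the lattice box\<close>

lemma finite_int_box: "finite {m :: int ^ 'n. \<forall>i. a i \<le> m $ i \<and> m $ i \<le> b i}"
proof (rule finite_subset)
  show "{m :: int ^ 'n. \<forall>i. a i \<le> m $ i \<and> m $ i \<le> b i}
      \<subseteq> vec_lambda ` (\<Pi>\<^sub>E i\<in>UNIV. {a i..b i})"
    by (auto simp: image_iff intro!: bexI[where x = "vec_nth _"])
  show "finite (vec_lambda ` (\<Pi>\<^sub>E i\<in>UNIV. {a i..b i}) :: (int ^ 'n) set)"
    by (intro finite_imageI finite_PiE) auto
qed

lemma lattice_point_diff_axis:
  "lattice_point h (m - axis j 1) = lattice_point h m - lattice_step h j"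
  by (simp add: lattice_point_def lattice_step_def vec_eq_iff axis_def algebra_simps)

lemma inj_lattice_point: "h \<noteq> 0 \<Longrightarrow> inj (lattice_point h)"
  by (auto simp: inj_def lattice_point_def vec_eq_iff)

text \<open>The box with its left face is the box with its right face shifted back by one step.
  Summing over both and removing the common interior leaves only the faces.\<close>

lemma telescope_lattice:
  fixes u :: "real ^ 8 \<Rightarrow> 'a::real_vector"
  assumes "h > 0" "N j \<ge> 1"
  shows "(\<Sum>m\<in>interior_indices N. u (lattice_point h m) - u (lattice_point h m - lattice_step h j))
    = (\<Sum>x\<in>right_boundary h N j. u (x - lattice_step h j)) - (\<Sum>x\<in>left_boundary h N j. u x)"
proof -
  define L where "L = {m :: int ^ 8. m $ j = 0 \<and> (\<forall>l. l \<noteq> j \<longrightarrow> 1 \<le> m $ l \<and> m $ l \<le> N l - 1)}"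
  define R where "R = {m :: int ^ 8. m $ j = N j \<and> (\<forall>l. l \<noteq> j \<longrightarrow> 1 \<le> m $ l \<and> m $ l \<le> N l - 1)}"
  define K where "K = interior_indices N"
  let ?s = "\<lambda>m :: int ^ 8. m - axis j 1"
  let ?v = "\<lambda>m. u (lattice_point h m)"
  \<comment> \<open>The faces are sets of real points; injectivity transfers their sums to integer
    indices.\<close>
  have inj: "inj_on (lattice_point h) A" for A
    using inj_lattice_point[of h] \<open>h > 0\<close> by (auto intro: inj_on_subset)
  have K: "m \<in> K \<longleftrightarrow>
      1 \<le> m $ j \<and> m $ j \<le> N j - 1 \<and> (\<forall>l. l \<noteq> j \<longrightarrow> 1 \<le> m $ l \<and> m $ l \<le> N l - 1)" for m
    unfolding K_def interior_indices_def mem_Collect_eq by metis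
  \<comment> \<open>With \<open>N j \<ge> 1\<close>, adding a face extends the range of coordinate
    \<open>j\<close> without a gap: to \<open>0, ..., N j - 1\<close> on the left and to
    \<open>1, ..., N j\<close> on the right.\<close>
  have KL: "m \<in> K \<union> L \<longleftrightarrow>
      0 \<le> m $ j \<and> m $ j \<le> N j - 1 \<and> (\<forall>l. l \<noteq> j \<longrightarrow> 1 \<le> m $ l \<and> m $ l \<le> N l - 1)" for m
    using \<open>N j \<ge> 1\<close> by (auto simp: K L_def)
  have KR: "m \<in> K \<union> R \<longleftrightarrow>
      1 \<le> m $ j \<and> m $ j \<le> N j \<and> (\<forall>l. l \<noteq> j \<longrightarrow> 1 \<le> m $ l \<and> m $ l \<le> N l - 1)" for m
    using \<open>N j \<ge> 1\<close> by (auto simp: K R_def)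
  have "finite (K \<union> L \<union> R)"
  proof (rule finite_subset[OF _ finite_int_box[of "\<lambda>i. 0" N]], clarify)
    fix m i assume "m \<in> K \<union> L \<union> R"
    then have "m \<in> K \<union> L \<or> m \<in> K \<union> R" by auto
    then have "0 \<le> m $ j \<and> m $ j \<le> N j" "i \<noteq> j \<Longrightarrow> 1 \<le> m $ i \<and> m $ i \<le> N i - 1"
      unfolding KL KR by auto
    then show "0 \<le> m $ i \<and> m $ i \<le> N i" by (cases "i = j") auto
  qed
  then have fin: "finite K" "finite L" "finite R" by auto
  have step: "m \<in> K \<union> L \<longleftrightarrow> m + axis j 1 \<in> K \<union> R" for m
    unfolding KL KR by (auto simp: axis_def)
  have shift: "K \<union> L = ?s ` (K \<union> R)"
  proof (intro equalityI subsetI)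
    fix m assume "m \<in> K \<union> L"
    then have "m + axis j 1 \<in> K \<union> R" by (simp only: step)
    then show "m \<in> ?s ` (K \<union> R)" by (rule rev_image_eqI) simp
  next
    fix m assume "m \<in> ?s ` (K \<union> R)"
    then obtain n where "n \<in> K \<union> R" "m = ?s n" by (rule imageE)
    then show "m \<in> K \<union> L" by (simp only: step diff_add_cancel)
  qed
  have "(\<Sum>m\<in>K. ?v m) + (\<Sum>m\<in>L. ?v m) = (\<Sum>m\<in>K \<union> L. ?v m)"
    using fin by (subst sum.union_disjoint) (auto simp: K L_def)
  also have "\<dots> = (\<Sum>m\<in>K \<union> R. ?v (?s m))"
    unfolding shift by (subst sum.reindex) (auto simp: inj_on_def)
  also have "\<dots> = (\<Sum>m\<in>K. ?v (?s m)) + (\<Sum>m\<in>R. ?v (?s m))"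
    using fin by (subst sum.union_disjoint) (auto simp: K R_def)
  finally show ?thesis
    unfolding left_boundary_def right_boundary_def L_def[symmetric] R_def[symmetric] K_def[symmetric]
    by (simp add: sum.reindex[OF inj] sum_subtractf lattice_point_diff_axis algebra_simps)
qed

section \<open>Assembling the volume and boundary terms\<close>

theorem theorem4:
  fixes h :: real
    and N :: "8 \<Rightarrow> int"
    and ep em e :: "8 \<Rightarrow> 'a :: real_nonassoc_algebra_1"
    and fc gc :: "8 \<Rightarrow> real ^ 8 \<Rightarrow> real"
    and f g :: "real ^ 8 \<Rightarrow> 'a"
  assumes "h > 0"
    and "\<And>i. N i \<ge> 2"
    and "weyl_octonion_splitting ep em"
    and "e = (\<lambda>j. ep j + em j)"
    and "f = discrete_fun e fc"
    and "g = discrete_fun e gc"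
  shows
    "(\<Sum>m\<in>interior_indices N. let x = lattice_point h m in
        h ^ 8 *\<^sub>R (D_right h ep em g x * f x + g x * D_left h ep em f x))
     = - (\<Sum>j\<in>UNIV. \<Sum>x\<in>left_boundary h N j.
            h ^ 7 *\<^sub>R (g x * (ep j * f (x + lattice_step h j))
                     + g (x + lattice_step h j) * (em j * f x)))
       + (\<Sum>j\<in>UNIV. \<Sum>x\<in>right_boundary h N j.
            h ^ 7 *\<^sub>R (g (x - lattice_step h j) * (ep j * f x)
                     + g x * (em j * f (x - lattice_step h j))))
       + 2 *\<^sub>R (\<Sum>m\<in>interior_indices N. let x = lattice_point h m in
            \<Sum>s\<in>{1..7}. \<Sum>i\<in>oct_triple s. \<Sum>j\<in>oct_triple s - {i}. \<Sum>k\<in>{1..7} - oct_triple s.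
              h ^ 8 *\<^sub>R ((gc i x * fwd_diff h j (fc k) x) *\<^sub>R (e i * (ep j * e k))
                       + (gc i x * bwd_diff h j (fc k) x) *\<^sub>R (e i * (em j * e k))))
       + 2 *\<^sub>R (\<Sum>s\<in>{1..7}. \<Sum>i\<in>oct_triple s. \<Sum>j\<in>oct_triple s - {i}. \<Sum>k\<in>{1..7} - oct_triple s.
            \<Sum>x\<in>left_boundary h N j.
              h ^ 7 *\<^sub>R ((gc i x * fc k (x + lattice_step h j)) *\<^sub>R (e i * (ep j * e k))
                       + (gc i (x + lattice_step h j) * fc k x) *\<^sub>R (e i * (em j * e k))))
       - 2 *\<^sub>R (\<Sum>s\<in>{1..7}. \<Sum>i\<in>oct_triple s. \<Sum>j\<in>oct_triple s - {i}. \<Sum>k\<in>{1..7} - oct_triple s.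
            \<Sum>x\<in>right_boundary h N j.
              h ^ 7 *\<^sub>R ((gc i (x - lattice_step h j) * fc k x) *\<^sub>R (e i * (ep j * e k))
                       + (gc i x * fc k (x - lattice_step h j)) *\<^sub>R (e i * (em j * e k))))"
proof -
  interpret weyl_octonion_splitting ep em by fact
  note e = \<open>e = (\<lambda>j. ep j + em j)\<close>
  let ?d = "lattice_step h"
  \<comment> \<open>\<open>V j x\<close> is the uncorrected flux across the edge from
    \<open>x\<close> to \<open>x + ?d j\<close>, so the right faces carry
    \<open>V j (x - ?d j)\<close>. \<open>W\<close> collects its components, \<open>C\<close> those
    of the volume residue, and \<open>U\<close> is the corrected flux, equal to
    \<open>P x + Q (x + ?d j)\<close> in the product rules.\<close>
  define V where "V = (\<lambda>j x. g x * (ep j * f (x + ?d j)) + g (x + ?d j) * (em j * f x))"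
  define W where "W = (\<lambda>j x i k. (gc i x * fc k (x + ?d j)) *\<^sub>R (e i * (ep j * e k))
    + (gc i (x + ?d j) * fc k x) *\<^sub>R (e i * (em j * e k)))"
  define C where "C = (\<lambda>j x i k. (gc i x * fwd_diff h j (fc k) x) *\<^sub>R (e i * (ep j * e k))
    + (gc i x * bwd_diff h j (fc k) x) *\<^sub>R (e i * (em j * e k)))"
  define U where "U = (\<lambda>j x. V j x - 2 *\<^sub>R antiassoc_sum j (W j x))"
  have pt: "h *\<^sub>R (D_right h ep em g x * f x + g x * D_left h ep em f x)
      = (\<Sum>j\<in>UNIV. U j x - U j (x - ?d j)) + (2 * h) *\<^sub>R (\<Sum>j\<in>UNIV. antiassoc_sum j (C j x))" for x
  proof -
    \<comment> \<open>Grouped by half: each \<open>ep j\<close> or \<open>em j\<close> meets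
      opposite differences on \<open>g\<close> and \<open>f\<close>, exactly the pairing of the
      product rules.\<close>
    have "h *\<^sub>R (D_right h ep em g x * f x + g x * D_left h ep em f x)
      = (\<Sum>j\<in>UNIV. h *\<^sub>R ((bwd_diff h j g x * ep j) * f x + g x * (ep j * fwd_diff h j f x))
          + h *\<^sub>R ((fwd_diff h j g x * em j) * f x + g x * (em j * bwd_diff h j f x)))"
      unfolding D_right_def D_left_def na_sum_left na_sum_right sum.distrib[symmetric] scaleR_sum_right
      by (simp add: na_distrib_left na_distrib_right scaleR_add_right add_ac)
    also have "\<dots> = (\<Sum>j\<in>UNIV. U j x - U j (x - ?d j) + (2 * h) *\<^sub>R antiassoc_sum j (C j x))"
    proof (rule sum.cong)
      fix j
      note fw = forward_product_rule[OF \<open>h > 0\<close> e, of "ep j" j gc x fc]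
      note bw = backward_product_rule[OF \<open>h > 0\<close> e, of "em j" j gc x fc]
      show "h *\<^sub>R ((bwd_diff h j g x * ep j) * f x + g x * (ep j * fwd_diff h j f x))
          + h *\<^sub>R ((fwd_diff h j g x * em j) * f x + g x * (em j * bwd_diff h j f x))
        = U j x - U j (x - ?d j) + (2 * h) *\<^sub>R antiassoc_sum j (C j x)"
        unfolding \<open>f = _\<close> \<open>g = _\<close> fw[simplified] bw[simplified] U_def V_def W_def C_def antiassoc_sum_add
        by (simp add: algebra_simps)
    qed simp
    finally show ?thesis by (simp add: sum.distrib scaleR_sum_right)
  qed
  have bdry: "(\<Sum>m\<in>interior_indices N. \<Sum>j\<in>UNIV. U j (lattice_point h m) - U j (lattice_point h m - ?d j))
    = (\<Sum>j\<in>UNIV. (\<Sum>x\<in>right_boundary h N j. U j (x - ?d j)) - (\<Sum>x\<in>left_boundary h N j. U j x))"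
    using order_trans[OF _ assms(2), of 1]
    by (subst sum.swap, intro sum.cong telescope_lattice refl \<open>h > 0\<close>) simp
  \<comment> \<open>One factor of \<open>h ^ 8\<close> is spent on clearing the difference
    quotients. This leaves \<open>h ^ 7\<close> on the faces, and \<open>h ^ 7\<close> times
    \<open>2 * h\<close> restores \<open>h ^ 8\<close> in the volume term.\<close>
  have "(\<Sum>m\<in>interior_indices N. let x = lattice_point h m in
        h ^ 8 *\<^sub>R (D_right h ep em g x * f x + g x * D_left h ep em f x))
    = (\<Sum>m\<in>interior_indices N. h ^ 7 *\<^sub>R (h *\<^sub>R (D_right h ep em g (lattice_point h m) * f (lattice_point h m)
        + g (lattice_point h m) * D_left h ep em f (lattice_point h m))))"
    by (simp add: Let_def flip: power_Suc2)
  also have "\<dots> = h ^ 7 *\<^sub>R (\<Sum>j\<in>UNIV. (\<Sum>x\<in>right_boundary h N j. U j (x - ?d j)) - (\<Sum>x\<in>left_boundary h N j. U j x))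
      + 2 *\<^sub>R (\<Sum>m\<in>interior_indices N. h ^ 8 *\<^sub>R (\<Sum>j\<in>UNIV. antiassoc_sum j (C j (lattice_point h m))))"
    unfolding pt unfolding scaleR_add_right sum.distrib scaleR_sum_right[symmetric] bdry
    by (simp add: scaleR_sum_right mult.assoc mult.left_commute flip: power_Suc2)
  also have "h ^ 7 *\<^sub>R (\<Sum>j\<in>UNIV. (\<Sum>x\<in>right_boundary h N j. U j (x - ?d j)) - (\<Sum>x\<in>left_boundary h N j. U j x))
    = - (\<Sum>j\<in>UNIV. \<Sum>x\<in>left_boundary h N j. h ^ 7 *\<^sub>R V j x)
      + (\<Sum>j\<in>UNIV. \<Sum>x\<in>right_boundary h N j. h ^ 7 *\<^sub>R V j (x - ?d j))
      + 2 *\<^sub>R (\<Sum>j\<in>UNIV. \<Sum>x\<in>left_boundary h N j. h ^ 7 *\<^sub>R antiassoc_sum j (W j x))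
      - 2 *\<^sub>R (\<Sum>j\<in>UNIV. \<Sum>x\<in>right_boundary h N j. h ^ 7 *\<^sub>R antiassoc_sum j (W j (x - ?d j)))"
    unfolding U_def sum_subtractf scaleR_sum_right[symmetric] scaleR_diff_right
    by (simp add: mult.commute)
  finally show ?thesis
    \<comment> \<open>The sums over triples in the goal take the form reached above:
      \<open>j\<close> goes outermost, and the sums over face points are pulled out of
      \<open>antiassoc_sum\<close>.\<close>
    unfolding sum_oct_triples Let_def antiassoc_sum_sum antiassoc_sum_scaleR
    unfolding V_def W_def C_def by (simp add: scaleR_sum_right)
qed

end
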